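(* Let $(X,\tau)$ be a QFS-space, let $f:X\to X$ be a quasicontinuous projection, and suppose that $f(X)$ with the subspace topology $\tau|_{f(X)}$ is a directed space. Then $f(X)$ is a QFS-space.
   Context: All topological spaces are $T_0$. For a space $(X,\tau)$, order-theoretic notions refer to the specialization order: $x\le y$ iff $x\in \mathrm{cl}_\tau\{y\}$. For $A\subseteq X$, $\uparrow A=\{x:\exists a\in A,\ a\le x\}$. A directed subset $D$ of $X$ (nonempty, every two elements have an upper bound in $D$), viewed as a net indexed by itself, converges to $x$, written $D\to_\tau x$, if it is eventually in every open neighbourhood of $x$. A set $U\subseteq X$ is directed open if for every directed $D$ and every $x\in U$ with $D\to_\tau x$ one has $D\cap U\neq\emptyset$; $d(X)$ is the family of directed open sets. $X$ is a directed space if $d(X)=\tau$. $\mathcal{P}^w(X)$ is the set of nonempty finite subsets of $X$. A nonempty family $\mathcal{F}\subseteq\mathcal{P}^w(X)$ is directed if for all $F_1,F_2\in\mathcal{F}$ there is $F\in\mathcal{F}$ with $F\subseteq\uparrow F_1\cap\uparrow F_2$; a directed family $\mathcal{F}$ converges to $x$, written $\mathcal{F}\to_\tau x$, if every open neighbourhood $U$ of $x$ contains some $F\in\mathcal{F}$ as a subset. For a family $\mathcal{F}\subseteq\mathcal{P}^w(X)$ and $H\in\mathcal{P}^w(X)$, $\mathcal{F}\Rightarrow_\tau H$ means: for every open $U\supseteq H$ there is $F\in\mathcal{F}$ with $F\subseteq U$. A function $f:X\to Y$ between directed spaces is quasicontinuous if it is monotone (that is, $H\subseteq\uparrow G$ implies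 $f(H)\subseteq\uparrow f(G)$) and, whenever $\mathcal{F}\subseteq\mathcal{P}^w(X)$ and $\mathcal{F}\Rightarrow_\tau H$, also $\{f(F):F\in\mathcal{F}\}\Rightarrow_\tau f(H)$ in $Y$. A projection is an idempotent self-map: $f\circ f=f$. For a directed space $X$, a map $\delta:X\to\mathcal{P}^w(X)$ is quasi-finitely separating if: (i) $a\le b$ implies $\delta(b)\subseteq\uparrow\delta(a)$; (ii) there is a finite set $F_\delta\subseteq X$ such that for every $x\in X$ there is $y\in F_\delta$ with $x\in\uparrow y\subseteq\uparrow\delta(x)$; (iii) for every directed $D\subseteq X$ with $D\to_\tau x$ and every open $U$ with $\delta(x)\subseteq U$, there is $d\in D$ with $\delta(d)\subseteq U$. A set $\mathcal{D}$ of maps $X\to\mathcal{P}^w(X)$ is directed if it is nonempty and for all $\delta_1,\delta_2\in\mathcal{D}$ there is $\delta\in\mathcal{D}$ with $\delta(x)\subseteq\uparrow\delta_1(x)\cap\uparrow\delta_2(x)$ for all $x\in X$. A quasi-approximate identity for $X$ is a directed set $\mathcal{D}$ of maps $X\to\mathcal{P}^w(X)$ such that for every $x\in X$, $\{\delta(x):\delta\in\mathcal{D}\}\to_\tau x$. A QFS-space is a directed space that has a quasi-approximate identity consisting of quasi-finitely separating maps. *)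

theory Defs
  imports "HOL-Analysis.Analysis"
begin

text \<open>
  A space is an abstract \<open>'a topology\<close> with carrier \<open>topspace X\<close>, so that the image of a
  projection can be treated as a space via \<open>subtopology\<close>. Maps between spaces are total HOL
  functions whose values outside the carrier are irrelevant.
\<close>

text \<open>Since \<open>X closure_of {y}\<close> is empty for \<open>y \<notin> topspace X\<close>, the relation \<open>spec_le X x y\<close>
  implies that both \<open>x\<close> and \<open>y\<close> lie in \<open>topspace X\<close>.\<close>

definition spec_le :: "'a topology \<Rightarrow> 'a \<Rightarrow> 'a \<Rightarrow> bool" where
  "spec_le X x y \<longleftrightarrow> x \<in> X closure_of {y}"

definition up :: "'a topology \<Rightarrow> 'a set \<Rightarrow> 'a set" where
  "up X A = {x. \<exists>a\<in>A. spec_le X a x}"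

definition directed_set :: "'a topology \<Rightarrow> 'a set \<Rightarrow> bool" where
  "directed_set X D \<longleftrightarrow>
     D \<subseteq> topspace X \<and> D \<noteq> {} \<and> (\<forall>a\<in>D. \<forall>b\<in>D. \<exists>c\<in>D. spec_le X a c \<and> spec_le X b c)"

text \<open>Convergence of a directed set as a net indexed by itself.\<close>

definition dir_converges :: "'a topology \<Rightarrow> 'a set \<Rightarrow> 'a \<Rightarrow> bool" where
  "dir_converges X D x \<longleftrightarrow> directed_set X D \<and> x \<in> topspace X \<and>
     (\<forall>U. openin X U \<and> x \<in> U \<longrightarrow> (\<exists>d\<in>D. \<forall>e\<in>D. spec_le X d e \<longrightarrow> e \<in> U))"

definition directed_opens :: "'a topology \<Rightarrow> 'a set set" where
  "directed_opens X =
     {U. U \<subseteq> topspace X \<and> (\<forall>D x. x \<in> U \<and> dir_converges X D x \<longrightarrow> D \<inter> U \<noteq> {})}"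

definition directed_space :: "'a topology \<Rightarrow> bool" where
  "directed_space X \<longleftrightarrow> t0_space X \<and> directed_opens X = {U. openin X U}"

definition Pw :: "'a topology \<Rightarrow> 'a set set" where
  "Pw X = {F. F \<subseteq> topspace X \<and> finite F \<and> F \<noteq> {}}"

definition directed_family :: "'a topology \<Rightarrow> 'a set set \<Rightarrow> bool" where
  "directed_family X \<F> \<longleftrightarrow> \<F> \<subseteq> Pw X \<and> \<F> \<noteq> {} \<and>
     (\<forall>F1\<in>\<F>. \<forall>F2\<in>\<F>. \<exists>F\<in>\<F>. F \<subseteq> up X F1 \<inter> up X F2)"

definition fam_converges :: "'a topology \<Rightarrow> 'a set set \<Rightarrow> 'a \<Rightarrow> bool" where
  "fam_converges X \<F> x \<longleftrightarrow> directed_family X \<F> \<and> x \<in> topspace X \<and>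
     (\<forall>U. openin X U \<and> x \<in> U \<longrightarrow> (\<exists>F\<in>\<F>. F \<subseteq> U))"

text \<open>The relation \<open>\<F> \<Rightarrow> H\<close>; here \<open>\<F>\<close> need not be directed.\<close>

definition fam_tends :: "'a topology \<Rightarrow> 'a set set \<Rightarrow> 'a set \<Rightarrow> bool" where
  "fam_tends X \<F> H \<longleftrightarrow> \<F> \<subseteq> Pw X \<and> H \<in> Pw X \<and>
     (\<forall>U. openin X U \<and> H \<subseteq> U \<longrightarrow> (\<exists>F\<in>\<F>. F \<subseteq> U))"

definition quasicontinuous :: "'a topology \<Rightarrow> 'b topology \<Rightarrow> ('a \<Rightarrow> 'b) \<Rightarrow> bool" where
  "quasicontinuous X Y f \<longleftrightarrow> directed_space X \<and> directed_space Y \<and>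
     f \<in> topspace X \<rightarrow> topspace Y \<and>
     (\<forall>G\<in>Pw X. \<forall>H\<in>Pw X. H \<subseteq> up X G \<longrightarrow> f ` H \<subseteq> up Y (f ` G)) \<and>
     (\<forall>\<F> H. fam_tends X \<F> H \<longrightarrow> fam_tends Y ((\<lambda>F. f ` F) ` \<F>) (f ` H))"

definition projection :: "'a topology \<Rightarrow> ('a \<Rightarrow> 'a) \<Rightarrow> bool" where
  "projection X f \<longleftrightarrow> f \<in> topspace X \<rightarrow> topspace X \<and> (\<forall>x\<in>topspace X. f (f x) = f x)"

definition quasi_finitely_separating :: "'a topology \<Rightarrow> ('a \<Rightarrow> 'a set) \<Rightarrow> bool" where
  "quasi_finitely_separating X \<delta> \<longleftrightarrow> \<delta> \<in> topspace X \<rightarrow> Pw X \<and>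
     (\<forall>a b. spec_le X a b \<longrightarrow> \<delta> b \<subseteq> up X (\<delta> a)) \<and>
     (\<exists>F. finite F \<and> F \<subseteq> topspace X \<and>
        (\<forall>x\<in>topspace X. \<exists>y\<in>F. x \<in> up X {y} \<and> up X {y} \<subseteq> up X (\<delta> x))) \<and>
     (\<forall>D x U. dir_converges X D x \<and> openin X U \<and> \<delta> x \<subseteq> U \<longrightarrow> (\<exists>d\<in>D. \<delta> d \<subseteq> U))"

definition directed_maps :: "'a topology \<Rightarrow> ('a \<Rightarrow> 'a set) set \<Rightarrow> bool" where
  "directed_maps X \<D> \<longleftrightarrow> \<D> \<subseteq> topspace X \<rightarrow> Pw X \<and> \<D> \<noteq> {} \<and>
     (\<forall>\<delta>1\<in>\<D>. \<forall>\<delta>2\<in>\<D>. \<exists>\<delta>\<in>\<D>. \<forall>x\<in>topspace X. \<delta> x \<subseteq> up X (\<delta>1 x) \<inter> up X (\<delta>2 x))"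

definition quasi_approximate_identity :: "'a topology \<Rightarrow> ('a \<Rightarrow> 'a set) set \<Rightarrow> bool" where
  "quasi_approximate_identity X \<D> \<longleftrightarrow> directed_maps X \<D> \<and>
     (\<forall>x\<in>topspace X. fam_converges X {\<delta> x |\<delta>. \<delta> \<in> \<D>} x)"

definition QFS_space :: "'a topology \<Rightarrow> bool" where
  "QFS_space X \<longleftrightarrow> directed_space X \<and>
     (\<exists>\<D>. quasi_approximate_identity X \<D> \<and> (\<forall>\<delta>\<in>\<D>. quasi_finitely_separating X \<delta>))"

end

theory Submission
  imports Defs
begin

text \<open>
  A quasicontinuous map is continuous, because it can be tested on families of singletons: if \<open>D\<close>
  is a directed set converging to \<open>x\<close>, then the singletons of \<open>D\<close> tend to \<open>{x}\<close>, so \<open>f\<close> maps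
  some member of \<open>D\<close> into any given open neighbourhood of \<open>f x\<close>. Preimages of open sets are
  therefore directed open, hence open (\<open>quasicontinuous_imp_continuous_map\<close>).
  Consequently a quasicontinuous projection is a topological retraction of the space onto its
  image, and the theorem reduces to the statement that a directed retract of a QFS-space is a
  QFS-space (\<open>QFS_space_retract\<close>).

  Let \<open>r : X \<rightarrow> Y\<close> be a retraction with section \<open>s : Y \<rightarrow> X\<close>. A map \<open>\<delta>\<close> on \<open>X\<close> is transported to
  \<open>y \<mapsto> r ` \<delta> (s y)\<close> on \<open>Y\<close>. Continuous maps are monotone and preserve limits of directed sets, so
  this construction preserves the order-theoretic conditions, with \<open>r ` F\<close> as the finite
  separating set when \<open>F\<close> is the one for \<open>\<delta>\<close>. The conditions that speak of an open set \<open>U\<close> of \<open>Y\<close>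
  are those for \<open>\<delta>\<close> and the open set \<open>r -` U\<close> of \<open>X\<close>. Since \<open>r (s y) = y\<close>, the transported maps
  again approximate the identity.
\<close>

lemma spec_le_iff_opens:
  "spec_le X x y \<longleftrightarrow> x \<in> topspace X \<and> y \<in> topspace X \<and> (\<forall>U. openin X U \<and> x \<in> U \<longrightarrow> y \<in> U)"
  unfolding spec_le_def closure_of_def by auto

lemma spec_le_trans: "spec_le X x y \<Longrightarrow> spec_le X y z \<Longrightarrow> spec_le X x z"
  by (auto simp: spec_le_iff_opens)

lemma spec_le_continuous_map:
  assumes f: "continuous_map X Y f" and le: "spec_le X x y"
  shows "spec_le Y (f x) (f y)"
proof -
  have "f y \<in> U" if "openin Y U" "f x \<in> U" for U
    using le openin_continuous_map_preimage[OF f \<open>openin Y U\<close>] \<open>f x \<in> U\<close>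
    by (auto simp: spec_le_iff_opens)
  moreover have "f x \<in> topspace Y" "f y \<in> topspace Y"
    using le continuous_map_image_subset_topspace[OF f] by (auto simp: spec_le_iff_opens)
  ultimately show ?thesis by (auto simp: spec_le_iff_opens)
qed

lemma up_continuous_map:
  assumes "continuous_map X Y f" and "A \<subseteq> up X B"
  shows "f ` A \<subseteq> up Y (f ` B)"
  using assms spec_le_continuous_map[OF assms(1)] unfolding up_def by blast

lemma Pw_continuous_map:
  assumes "continuous_map X Y f" and "A \<in> Pw X"
  shows "f ` A \<in> Pw Y"
  using assms continuous_map_image_subset_topspace[OF assms(1)] unfolding Pw_def by blast

text \<open>
  The image net may have order relations that do not come from \<open>D\<close>. This is harmless: open sets
  are upward closed, so a directed set lies eventually in \<open>U\<close> as soon as it meets \<open>U\<close>.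
\<close>

lemma dir_converges_continuous_map:
  assumes f: "continuous_map X Y f" and D: "dir_converges X D x"
  shows "dir_converges Y (f ` D) (f x)"
  unfolding dir_converges_def
proof (intro conjI allI impI)
  have dir: "directed_set X D" and x: "x \<in> topspace X"
    using D by (auto simp: dir_converges_def)
  show "f x \<in> topspace Y"
    using x continuous_map_image_subset_topspace[OF f] by auto
  show "directed_set Y (f ` D)"
    unfolding directed_set_def
  proof (intro conjI)
    show "f ` D \<subseteq> topspace Y"
      using dir continuous_map_image_subset_topspace[OF f] by (auto simp: directed_set_def)
    show "f ` D \<noteq> {}" using dir by (auto simp: directed_set_def)
    show "\<forall>a\<in>f ` D. \<forall>b\<in>f ` D. \<exists>c\<in>f ` D. spec_le Y a c \<and> spec_le Y b c"
      using dir spec_le_continuous_map[OF f] unfolding directed_set_def by blast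
  qed
  fix U assume U: "openin Y U \<and> f x \<in> U"
  then have "openin X {z \<in> topspace X. f z \<in> U}"
    using openin_continuous_map_preimage[OF f] by auto
  moreover have "x \<in> {z \<in> topspace X. f z \<in> U}" using U x by auto
  ultimately have "\<exists>d\<in>D. \<forall>e\<in>D. spec_le X d e \<longrightarrow> e \<in> {z \<in> topspace X. f z \<in> U}"
    using D unfolding dir_converges_def by meson
  then obtain d where d: "d \<in> D" "\<And>e. e \<in> D \<Longrightarrow> spec_le X d e \<Longrightarrow> f e \<in> U"
    by blast
  have "spec_le X d d"
    using d(1) dir by (auto simp: spec_le_iff_opens directed_set_def)
  then have "f d \<in> U" using d by blast
  then show "\<exists>d\<in>f ` D. \<forall>e\<in>f ` D. spec_le Y d e \<longrightarrow> e \<in> U"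
    using d(1) U by (auto simp: spec_le_iff_opens)
qed

text \<open>A directed set, cut into singletons, is a special case of the families that quasicontinuity
  speaks of.\<close>

lemma dir_converges_imp_fam_tends:
  assumes "dir_converges X D x"
  shows "fam_tends X ((\<lambda>d. {d}) ` D) {x}"
  unfolding fam_tends_def
proof (intro conjI allI impI)
  have dir: "directed_set X D" and x: "x \<in> topspace X"
    using assms by (auto simp: dir_converges_def)
  show "(\<lambda>d. {d}) ` D \<subseteq> Pw X" using dir by (auto simp: directed_set_def Pw_def)
  show "{x} \<in> Pw X" using x by (auto simp: Pw_def)
  fix U assume "openin X U \<and> {x} \<subseteq> U"
  then obtain d where d: "d \<in> D" "\<forall>e\<in>D. spec_le X d e \<longrightarrow> e \<in> U"
    using assms unfolding dir_converges_def by auto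
  moreover have "spec_le X d d"
    using d(1) dir by (auto simp: spec_le_iff_opens directed_set_def)
  ultimately show "\<exists>F\<in>(\<lambda>d. {d}) ` D. F \<subseteq> U" by auto
qed

text \<open>Openness in a directed space is tested on directed sets alone, so the singleton families
  above already decide continuity.\<close>

lemma quasicontinuous_imp_continuous_map:
  assumes "quasicontinuous X Y f"
  shows "continuous_map X Y f"
  unfolding continuous_map_def
proof (intro conjI allI impI)
  have dX: "directed_opens X = {U. openin X U}"
    and tends: "\<And>\<F> H. fam_tends X \<F> H \<Longrightarrow> fam_tends Y ((\<lambda>F. f ` F) ` \<F>) (f ` H)"
    using assms by (auto simp: quasicontinuous_def directed_space_def)
  show "f \<in> topspace X \<rightarrow> topspace Y"
    using assms by (simp add: quasicontinuous_def)
  fix U assume U: "openin Y U"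
  let ?P = "{x \<in> topspace X. f x \<in> U}"
  have "D \<inter> ?P \<noteq> {}" if x: "x \<in> ?P" and D: "dir_converges X D x" for D x
  proof -
    have "\<exists>F\<in>(\<lambda>F. f ` F) ` (\<lambda>d. {d}) ` D. F \<subseteq> U"
      using tends[OF dir_converges_imp_fam_tends[OF D]] U x unfolding fam_tends_def by auto
    then obtain d where "d \<in> D" "f d \<in> U" by auto
    moreover have "D \<subseteq> topspace X"
      using D by (auto simp: dir_converges_def directed_set_def)
    ultimately show ?thesis by auto
  qed
  then have "?P \<in> directed_opens X" unfolding directed_opens_def by blast
  then show "openin X ?P" using dX by simp
qed

text \<open>
  The interpolating point for \<open>y\<close> is \<open>r z\<close>, where \<open>z\<close> interpolates between \<open>\<delta> (s y)\<close> and \<open>s y\<close>: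
  monotonicity of \<open>r\<close> carries \<open>w \<le> z \<le> s y\<close> with \<open>w \<in> \<delta> (s y)\<close> to \<open>r w \<le> r z \<le> r (s y) = y\<close>.
\<close>

lemma quasi_finitely_separating_retract:
  assumes rs: "retraction_maps X Y r s" and qfs: "quasi_finitely_separating X \<delta>"
  shows "quasi_finitely_separating Y (\<lambda>y. r ` \<delta> (s y))"
  unfolding quasi_finitely_separating_def
proof (intro conjI allI impI)
  have r: "continuous_map X Y r" and s: "continuous_map Y X s"
    and rs_id: "\<And>y. y \<in> topspace Y \<Longrightarrow> r (s y) = y"
    using rs by (auto simp: retraction_maps_def)
  have s_in: "s y \<in> topspace X" if "y \<in> topspace Y" for y
    using continuous_map_image_subset_topspace[OF s] that by auto
  have \<delta>_Pw: "\<delta> x \<in> Pw X" if "x \<in> topspace X" for x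
    using qfs that unfolding quasi_finitely_separating_def by blast
  show "(\<lambda>y. r ` \<delta> (s y)) \<in> topspace Y \<rightarrow> Pw Y"
    using s_in \<delta>_Pw Pw_continuous_map[OF r] by auto
  show "r ` \<delta> (s b) \<subseteq> up Y (r ` \<delta> (s a))" if "spec_le Y a b" for a b
    using qfs spec_le_continuous_map[OF s that] up_continuous_map[OF r]
    unfolding quasi_finitely_separating_def by blast
  show "\<exists>F. finite F \<and> F \<subseteq> topspace Y \<and>
    (\<forall>y\<in>topspace Y. \<exists>z\<in>F. y \<in> up Y {z} \<and> up Y {z} \<subseteq> up Y (r ` \<delta> (s y)))"
  proof -
    obtain F where F: "finite F" "F \<subseteq> topspace X"
      and sep: "\<And>x. x \<in> topspace X \<Longrightarrow> \<exists>z\<in>F. x \<in> up X {z} \<and> up X {z} \<subseteq> up X (\<delta> x)"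
      using qfs unfolding quasi_finitely_separating_def by blast
    have "\<exists>z\<in>r ` F. y \<in> up Y {z} \<and> up Y {z} \<subseteq> up Y (r ` \<delta> (s y))"
      if y: "y \<in> topspace Y" for y
    proof -
      obtain z where z: "z \<in> F" "s y \<in> up X {z}" "up X {z} \<subseteq> up X (\<delta> (s y))"
        using sep[OF s_in[OF y]] by blast
      have "spec_le Y (r z) (r (s y))"
        using z(2) spec_le_continuous_map[OF r] by (auto simp: up_def)
      then have "y \<in> up Y {r z}" by (simp add: up_def rs_id[OF y])
      moreover have "z \<in> up X {z}"
        using z(1) F(2) by (auto simp: up_def spec_le_iff_opens)
      then obtain w where w: "w \<in> \<delta> (s y)" "spec_le X w z"
        using z(3) by (auto simp: up_def)
      have "up Y {r z} \<subseteq> up Y (r ` \<delta> (s y))"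
        using w(1) spec_le_trans[OF spec_le_continuous_map[OF r w(2)]] by (auto simp: up_def)
      ultimately show ?thesis using z(1) by blast
    qed
    moreover have "r ` F \<subseteq> topspace Y"
      using F(2) continuous_map_image_subset_topspace[OF r] by blast
    ultimately show ?thesis using F(1) by blast
  qed
  show "\<exists>d\<in>D. r ` \<delta> (s d) \<subseteq> U"
    if D: "dir_converges Y D y \<and> openin Y U \<and> r ` \<delta> (s y) \<subseteq> U" for D y U
  proof -
    let ?V = "{x \<in> topspace X. r x \<in> U}"
    have "dir_converges X (s ` D) (s y)"
      using D dir_converges_continuous_map[OF s] by blast
    moreover have "openin X ?V"
      using D openin_continuous_map_preimage[OF r] by blast
    moreover have "\<delta> (s y) \<subseteq> ?V"
      using D \<delta>_Pw[OF s_in[of y]] by (auto simp: dir_converges_def Pw_def)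
    ultimately have "\<exists>x\<in>s ` D. \<delta> x \<subseteq> ?V"
      using qfs unfolding quasi_finitely_separating_def by blast
    then show ?thesis by blast
  qed
qed

text \<open>
  The sets \<open>\<delta> (s y)\<close> converge to \<open>s y\<close>, and the continuous map \<open>r\<close> carries this convergence to
  \<open>r (s y) = y\<close>.
\<close>

lemma quasi_approximate_identity_retract:
  assumes rs: "retraction_maps X Y r s" and qai: "quasi_approximate_identity X \<D>"
  shows "quasi_approximate_identity Y ((\<lambda>\<delta> y. r ` \<delta> (s y)) ` \<D>)"
proof -
  let ?T = "\<lambda>\<delta> y. r ` \<delta> (s y)"
  have r: "continuous_map X Y r" and s: "continuous_map Y X s"
    and rs_id: "\<And>y. y \<in> topspace Y \<Longrightarrow> r (s y) = y"
    using rs by (auto simp: retraction_maps_def)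
  have s_in: "s y \<in> topspace X" if "y \<in> topspace Y" for y
    using continuous_map_image_subset_topspace[OF s] that by auto
  have ne: "\<D> \<noteq> {}"
    and \<delta>_Pw: "\<And>\<delta> x. \<delta> \<in> \<D> \<Longrightarrow> x \<in> topspace X \<Longrightarrow> \<delta> x \<in> Pw X"
    and dir: "\<And>\<delta>1 \<delta>2. \<delta>1 \<in> \<D> \<Longrightarrow> \<delta>2 \<in> \<D> \<Longrightarrow>
      \<exists>\<delta>\<in>\<D>. \<forall>x\<in>topspace X. \<delta> x \<subseteq> up X (\<delta>1 x) \<inter> up X (\<delta>2 x)"
    and conv: "\<And>x. x \<in> topspace X \<Longrightarrow> fam_converges X {\<delta> x |\<delta>. \<delta> \<in> \<D>} x"
    using qai unfolding quasi_approximate_identity_def directed_maps_def by blast+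
  have T_Pw: "?T \<delta> y \<in> Pw Y" if "\<delta> \<in> \<D>" "y \<in> topspace Y" for \<delta> y
    using \<delta>_Pw s_in Pw_continuous_map[OF r] that by blast
  have T_dir: "\<exists>\<delta>\<in>\<D>. \<forall>y\<in>topspace Y. ?T \<delta> y \<subseteq> up Y (?T \<delta>1 y) \<inter> up Y (?T \<delta>2 y)"
    if \<delta>12: "\<delta>1 \<in> \<D>" "\<delta>2 \<in> \<D>" for \<delta>1 \<delta>2
  proof -
    obtain \<delta> where \<delta>: "\<delta> \<in> \<D>" "\<And>x. x \<in> topspace X \<Longrightarrow> \<delta> x \<subseteq> up X (\<delta>1 x) \<inter> up X (\<delta>2 x)"
      using dir[OF \<delta>12] by blast
    have "?T \<delta> y \<subseteq> up Y (?T \<delta>1 y) \<inter> up Y (?T \<delta>2 y)" if "y \<in> topspace Y" for y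
      using \<delta>(2)[OF s_in[OF that]] up_continuous_map[OF r] by (meson le_inf_iff)
    then show ?thesis using \<delta>(1) by blast
  qed
  have T_conv: "fam_converges Y {\<delta> y |\<delta>. \<delta> \<in> ?T ` \<D>} y" if y: "y \<in> topspace Y" for y
  proof -
    have eq: "{\<delta> y |\<delta>. \<delta> \<in> ?T ` \<D>} = (\<lambda>\<delta>. ?T \<delta> y) ` \<D>" by auto
    have "directed_family Y ((\<lambda>\<delta>. ?T \<delta> y) ` \<D>)"
      unfolding directed_family_def
    proof (intro conjI)
      show "(\<lambda>\<delta>. ?T \<delta> y) ` \<D> \<subseteq> Pw Y" using T_Pw[OF _ y] by (rule image_subsetI)
      show "(\<lambda>\<delta>. ?T \<delta> y) ` \<D> \<noteq> {}" using ne by simp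
      have "\<exists>\<delta>\<in>\<D>. ?T \<delta> y \<subseteq> up Y (?T \<delta>1 y) \<inter> up Y (?T \<delta>2 y)"
        if "\<delta>1 \<in> \<D>" "\<delta>2 \<in> \<D>" for \<delta>1 \<delta>2
        using T_dir[OF that] y by meson
      then show "\<forall>F1\<in>(\<lambda>\<delta>. ?T \<delta> y) ` \<D>. \<forall>F2\<in>(\<lambda>\<delta>. ?T \<delta> y) ` \<D>.
          \<exists>F\<in>(\<lambda>\<delta>. ?T \<delta> y) ` \<D>. F \<subseteq> up Y F1 \<inter> up Y F2"
        by simp
    qed
    moreover have "\<exists>F\<in>(\<lambda>\<delta>. ?T \<delta> y) ` \<D>. F \<subseteq> U" if U: "openin Y U" "y \<in> U" for U
    proof -
      let ?V = "{x \<in> topspace X. r x \<in> U}"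
      have "openin X ?V" using U openin_continuous_map_preimage[OF r] by simp
      moreover have "s y \<in> ?V" using U y s_in rs_id by simp
      ultimately have "\<exists>F\<in>{\<delta> (s y) |\<delta>. \<delta> \<in> \<D>}. F \<subseteq> ?V"
        using conv[OF s_in[OF y]] unfolding fam_converges_def by meson
      then obtain \<delta> where \<delta>: "\<delta> \<in> \<D>" "\<delta> (s y) \<subseteq> ?V" by auto
      have "?T \<delta> y \<subseteq> U" using \<delta>(2) by auto
      then show ?thesis using \<delta>(1) by blast
    qed
    ultimately show ?thesis using y unfolding fam_converges_def eq by simp
  qed
  have "directed_maps Y (?T ` \<D>)"
    unfolding directed_maps_def
  proof (intro conjI)
    show "?T ` \<D> \<subseteq> topspace Y \<rightarrow> Pw Y" using T_Pw by blast
    show "?T ` \<D> \<noteq> {}" using ne by blast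
    show "\<forall>\<delta>1\<in>?T ` \<D>. \<forall>\<delta>2\<in>?T ` \<D>. \<exists>\<delta>\<in>?T ` \<D>.
        \<forall>y\<in>topspace Y. \<delta> y \<subseteq> up Y (\<delta>1 y) \<inter> up Y (\<delta>2 y)"
      using T_dir by simp
  qed
  then show ?thesis using T_conv by (simp add: quasi_approximate_identity_def)
qed

lemma QFS_space_retract:
  assumes "retraction_maps X Y r s" and "QFS_space X" and "directed_space Y"
  shows "QFS_space Y"
proof -
  obtain \<D> where "quasi_approximate_identity X \<D>"
    and "\<And>\<delta>. \<delta> \<in> \<D> \<Longrightarrow> quasi_finitely_separating X \<delta>"
    using assms(2) by (auto simp: QFS_space_def)
  then have "quasi_approximate_identity Y ((\<lambda>\<delta> y. r ` \<delta> (s y)) ` \<D>)"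
    and "\<forall>\<delta>'\<in>(\<lambda>\<delta> y. r ` \<delta> (s y)) ` \<D>. quasi_finitely_separating Y \<delta>'"
    using quasi_approximate_identity_retract[OF assms(1)]
      quasi_finitely_separating_retract[OF assms(1)] by simp_all
  then show ?thesis using assms(3) unfolding QFS_space_def by meson
qed

theorem theorem4p4:
  fixes X :: "'a topology" and f :: "'a \<Rightarrow> 'a"
  assumes "QFS_space X"
    and "quasicontinuous X X f"
    and "projection X f"
    and "directed_space (subtopology X (f ` topspace X))"
  shows "QFS_space (subtopology X (f ` topspace X))"
proof (rule QFS_space_retract)
  show "retraction_maps X (subtopology X (f ` topspace X)) f id"
    using quasicontinuous_imp_continuous_map[OF assms(2)] assms(3)
    by (auto simp: retraction_maps_def projection_def continuous_map_in_subtopology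
        continuous_map_from_subtopology)
qed (fact assms)+

end
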